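(* For $R>1$, put $A_R=\{z\in\mathbb{C}: 1/R\le |z|\le R\}$. Let $K(R)$ denote the smallest positive constant such that, for every complex Hilbert space $H$ and every invertible bounded linear operator $T\in\mathcal{B}(H)$ with $\|T\|\le R$ and $\|T^{-1}\|\le R$, the set $A_R$ is a $K(R)$-spectral set for $T$. Then $$K(R)\ge 2 \quad \text{for all } R>1.$$
   Context: $\mathcal{B}(H)$ denotes the algebra of bounded linear operators on the complex Hilbert space $H$, and $\sigma(T)$ the spectrum of $T$. For a closed set $X\subseteq\mathbb{C}$, $\mathcal{R}(X)$ denotes the algebra of complex-valued bounded rational functions on $X$ (so their poles lie outside $X$), equipped with the supremum norm $\|f\|_X=\sup\{|f(x)|:x\in X\}$. If $T\in\mathcal{B}(H)$ has $\sigma(T)\subseteq X$ and $f=p/q\in\mathcal{R}(X)$ with $p,q$ polynomials, $q$ having no zeros in $X$, then $f(T):=p(T)q(T)^{-1}$. For a constant $K>0$, the set $X$ is called a $K$-spectral set for $T$ if $\sigma(T)\subseteq X$ and $\|f(T)\|\le K\|f\|_X$ for every $f\in\mathcal{R}(X)$. (It is known that for each $R>1$ some finite constant $K$ works uniformly for all $H$ and $T$ as in the claim, so $K(R)$ is a well-defined finite number.) *)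

theory Defs
  imports
    "HOL-Analysis.Analysis"
    "HOL-Algebra.Module"
    "HOL-Computational_Algebra.Polynomial"
begin

section \<open>Complex Hilbert spaces on a carrier set\<close>

text \<open>
  The constant \<open>K(R)\<close> is defined by a quantification over Hilbert spaces, so Hilbert spaces have to
  be objects of the logic: they are modules over the field of complex numbers in the sense of
  HOL-Algebra, together with an inner product. The \<open>mult\<close> and \<open>one\<close> fields that the
  record type inherits from rings are not used.
\<close>

definition complex_ring :: "complex ring" where
  "complex_ring = \<lparr>carrier = UNIV, mult = (*), one = 1, zero = 0, add = (+)\<rparr>"

record 'a inner_module = "(complex, 'a) module" +
  inner_prod :: "'a \<Rightarrow> 'a \<Rightarrow> complex"

definition vnorm :: "'a inner_module \<Rightarrow> 'a \<Rightarrow> real" where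
  "vnorm H x = sqrt (Re (inner_prod H x x))"

locale complex_hilbert_space =
  Module.module complex_ring H for H :: "'a inner_module" +
  assumes inner_add_left:
      "\<lbrakk>x \<in> carrier H; y \<in> carrier H; z \<in> carrier H\<rbrakk>
        \<Longrightarrow> inner_prod H (x \<oplus>\<^bsub>H\<^esub> y) z = inner_prod H x z + inner_prod H y z"
    and inner_smult_left:
      "\<lbrakk>x \<in> carrier H; y \<in> carrier H\<rbrakk> \<Longrightarrow> inner_prod H (c \<odot>\<^bsub>H\<^esub> x) y = c * inner_prod H x y"
    and inner_commute:
      "\<lbrakk>x \<in> carrier H; y \<in> carrier H\<rbrakk> \<Longrightarrow> inner_prod H x y = cnj (inner_prod H y x)"
    and inner_pos:
      "\<lbrakk>x \<in> carrier H; x \<noteq> \<zero>\<^bsub>H\<^esub>\<rbrakk> \<Longrightarrow> 0 < Re (inner_prod H x x)"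
    and complete:
      "\<lbrakk>range s \<subseteq> carrier H;
        \<forall>e>0. \<exists>N. \<forall>m\<ge>N. \<forall>n\<ge>N. vnorm H (s m \<ominus>\<^bsub>H\<^esub> s n) < e\<rbrakk>
        \<Longrightarrow> \<exists>l\<in>carrier H. (\<lambda>n. vnorm H (s n \<ominus>\<^bsub>H\<^esub> l)) \<longlonglongrightarrow> 0"


section \<open>Bounded operators\<close>

text \<open>
  Operators are HOL functions whose values outside the carrier are irrelevant; in particular
  equality of operators means equality on the carrier.
\<close>

definition bounded_op :: "'a inner_module \<Rightarrow> ('a \<Rightarrow> 'a) \<Rightarrow> bool" where
  "bounded_op H T \<longleftrightarrow>
     T \<in> carrier H \<rightarrow> carrier H \<and>
     (\<forall>x\<in>carrier H. \<forall>y\<in>carrier H. T (x \<oplus>\<^bsub>H\<^esub> y) = T x \<oplus>\<^bsub>H\<^esub> T y) \<and>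
     (\<forall>c. \<forall>x\<in>carrier H. T (c \<odot>\<^bsub>H\<^esub> x) = c \<odot>\<^bsub>H\<^esub> T x) \<and>
     (\<exists>B. \<forall>x\<in>carrier H. vnorm H (T x) \<le> B * vnorm H x)"

definition op_norm :: "'a inner_module \<Rightarrow> ('a \<Rightarrow> 'a) \<Rightarrow> real" where
  "op_norm H T = (SUP x\<in>{x \<in> carrier H. vnorm H x \<le> 1}. vnorm H (T x))"

definition invertible_op :: "'a inner_module \<Rightarrow> ('a \<Rightarrow> 'a) \<Rightarrow> bool" where
  "invertible_op H T \<longleftrightarrow>
     (\<exists>S. bounded_op H S \<and> (\<forall>x\<in>carrier H. S (T x) = x \<and> T (S x) = x))"

definition op_inverse :: "'a inner_module \<Rightarrow> ('a \<Rightarrow> 'a) \<Rightarrow> 'a \<Rightarrow> 'a" where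
  "op_inverse H T = inv_into (carrier H) T"

definition spectrum :: "'a inner_module \<Rightarrow> ('a \<Rightarrow> 'a) \<Rightarrow> complex set" where
  "spectrum H T = {z. \<not> invertible_op H (\<lambda>x. T x \<ominus>\<^bsub>H\<^esub> z \<odot>\<^bsub>H\<^esub> x)}"


section \<open>Rational functional calculus and spectral sets\<close>

definition poly_op :: "'a inner_module \<Rightarrow> complex poly \<Rightarrow> ('a \<Rightarrow> 'a) \<Rightarrow> 'a \<Rightarrow> 'a" where
  "poly_op H p T x =
     finsum H (\<lambda>i. coeff p i \<odot>\<^bsub>H\<^esub> (T ^^ i) x) {..degree p}"

definition rational_op ::
    "'a inner_module \<Rightarrow> complex poly \<Rightarrow> complex poly \<Rightarrow> ('a \<Rightarrow> 'a) \<Rightarrow> 'a \<Rightarrow> 'a" where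
  "rational_op H p q T = poly_op H p T \<circ> op_inverse H (poly_op H q T)"

text \<open>The pair \<open>(p, q)\<close> represents the element \<open>p / q\<close> of the algebra \<open>\<R>(X)\<close>.\<close>

definition bounded_rational_on :: "complex set \<Rightarrow> complex poly \<Rightarrow> complex poly \<Rightarrow> bool" where
  "bounded_rational_on X p q \<longleftrightarrow>
     q \<noteq> 0 \<and> (\<forall>z\<in>X. poly q z \<noteq> 0) \<and> bounded ((\<lambda>z. poly p z / poly q z) ` X)"

definition sup_norm_on :: "complex set \<Rightarrow> (complex \<Rightarrow> complex) \<Rightarrow> real" where
  "sup_norm_on X f = (SUP z\<in>X. cmod (f z))"

definition spectral_set :: "'a inner_module \<Rightarrow> ('a \<Rightarrow> 'a) \<Rightarrow> real \<Rightarrow> complex set \<Rightarrow> bool" where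
  "spectral_set H T K X \<longleftrightarrow>
     0 < K \<and> closed X \<and> spectrum H T \<subseteq> X \<and>
     (\<forall>p q. bounded_rational_on X p q \<longrightarrow>
        op_norm H (rational_op H p q T) \<le> K * sup_norm_on X (\<lambda>z. poly p z / poly q z))"


section \<open>The spectral constant of the annulus\<close>

definition closed_annulus :: "real \<Rightarrow> complex set" where
  "closed_annulus R = {z. 1 / R \<le> cmod z \<and> cmod z \<le> R}"

text \<open>
  The type argument is the universe from which the Hilbert spaces are taken: \<open>H\<close> ranges over all
  complex Hilbert spaces whose underlying set is a set of elements of \<open>'a\<close>.
\<close>

definition annulus_bound :: "'a itself \<Rightarrow> real \<Rightarrow> real \<Rightarrow> bool" where
  "annulus_bound _ R K \<longleftrightarrow>
     0 < K \<and>
     (\<forall>(H :: 'a inner_module) T.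
        complex_hilbert_space H \<and> bounded_op H T \<and> invertible_op H T \<and>
        op_norm H T \<le> R \<and> op_norm H (op_inverse H T) \<le> R \<longrightarrow>
        spectral_set H T K (closed_annulus R))"

text \<open>
  \<open>K(R)\<close> is an infimum in the extended reals, so that the definition does not presuppose
  that some finite constant works. The two lemmas below show that it is the smallest
  constant: it agrees with the least admissible constant if there is one, and it is itself
  admissible as soon as it is positive and some constant is admissible.
\<close>

definition annulus_constant :: "'a itself \<Rightarrow> real \<Rightarrow> ereal" where
  "annulus_constant U R = Inf (ereal ` {K. annulus_bound U R K})"

lemma annulus_constant_eqI:
  assumes "annulus_bound U R K" "\<And>L. annulus_bound U R L \<Longrightarrow> K \<le> L"
  shows "annulus_constant U R = ereal K"
  unfolding annulus_constant_def
  by (rule antisym) (auto intro!: Inf_lower Inf_greatest assms)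

lemma annulus_constant_attained:
  assumes R: "1 < R" and K0: "annulus_bound U R K0" and pos: "0 < annulus_constant U R"
  obtains K where "annulus_constant U R = ereal K" "annulus_bound U R K"
proof -
  have le: "annulus_constant U R \<le> ereal L" if "annulus_bound U R L" for L
    unfolding annulus_constant_def using that by (auto intro!: Inf_lower)
  obtain K where K: "annulus_constant U R = ereal K"
    using le[OF K0] pos by (cases "annulus_constant U R") auto
  have "spectral_set H T K (closed_annulus R)"
    if hyp: "complex_hilbert_space H \<and> bounded_op H T \<and> invertible_op H T \<and>
        op_norm H T \<le> R \<and> op_norm H (op_inverse H T) \<le> R" for H :: "'a inner_module" and T
  proof -
    have S: "spectral_set H T L (closed_annulus R)" if "annulus_bound U R L" for L
      using that hyp unfolding annulus_bound_def by blast
    have "op_norm H (rational_op H p q T) \<le>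
          K * sup_norm_on (closed_annulus R) (\<lambda>z. poly p z / poly q z)"
      if pq: "bounded_rational_on (closed_annulus R) p q" for p q
    proof -
      let ?a = "op_norm H (rational_op H p q T)"
      let ?s = "sup_norm_on (closed_annulus R) (\<lambda>z. poly p z / poly q z)"
      have a: "?a \<le> L * ?s" if "annulus_bound U R L" for L
        using S[OF that] pq unfolding spectral_set_def by blast
      have "bdd_above ((\<lambda>z. cmod (poly p z / poly q z)) ` closed_annulus R)"
        using pq unfolding bounded_rational_on_def bounded_iff bdd_above_def by auto
      moreover have "1 \<in> closed_annulus R"
        using R by (simp add: closed_annulus_def)
      ultimately have s0: "0 \<le> ?s"
        unfolding sup_norm_on_def by (rule cSUP_upper2) auto
      show ?thesis
      proof (cases "?s = 0")
        case True
        with a[OF K0] show ?thesis by simp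
      next
        case False
        with s0 have s: "0 < ?s" by simp
        have "ereal (?a / ?s) \<le> annulus_constant U R"
          unfolding annulus_constant_def
          using a s by (auto intro!: Inf_greatest simp: divide_simps)
        with s show ?thesis by (simp add: K divide_simps)
      qed
    qed
    moreover have "0 < K" using pos K by simp
    ultimately show ?thesis
      using S[OF K0] unfolding spectral_set_def by blast
  qed
  moreover have "0 < K" using pos K by simp
  ultimately have "annulus_bound U R K"
    unfolding annulus_bound_def by blast
  with K show ?thesis by (rule that)
qed

end

theory Submission
  imports Defs
begin

text \<open>
  On \<open>\<complex>\<^bsup>2n\<^esup>\<close> consider the cyclic weighted shift \<open>T\<close> with \<open>n\<close> consecutive weights \<open>R\<close> followed by
  \<open>n\<close> weights \<open>1/R\<close>. Both \<open>T\<close> and its inverse have norm \<open>R\<close>, and \<open>T\<^bsup>2n\<^esup> = 1\<close>, so that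
  \<open>f(T) = 2 R\<^bsup>-n\<^esup> T\<^bsup>n\<^esup>\<close> for \<open>f(z) = R\<^bsup>-n\<^esup> (z\<^bsup>n\<^esup> + z\<^bsup>-n\<^esup>)\<close>. Since \<open>T\<^bsup>n\<^esup>\<close> picks up all
  the weights \<open>R\<close> on some basis vector, \<open>f(T)\<close> has norm \<open>2\<close>, while \<open>\<bar>f\<bar> \<le> 1 + R\<^bsup>-2n\<^esup>\<close> on the
  annulus. Letting \<open>n\<close> tend to infinity gives the bound \<open>2\<close>.
\<close>

section \<open>Coordinate spaces inside an arbitrary type\<close>

text \<open>Vectors of C^m are functions on all of \<open>nat\<close>, so that one injection of
  \<open>nat => complex\<close> into the target type serves every dimension.\<close>

definition coord_vectors :: "nat \<Rightarrow> (nat \<Rightarrow> complex) set" where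
  "coord_vectors m = {f. \<forall>i\<ge>m. f i = 0}"

text \<open>C^m with its standard inner product, transported along an injection
  \<open>\<iota>\<close> so that it lives inside the prescribed type; \<open>inv_into\<close>
  recovers the coordinates.\<close>

definition coord_space :: "((nat \<Rightarrow> complex) \<Rightarrow> 'a) \<Rightarrow> nat \<Rightarrow> 'a inner_module" where
  "coord_space \<iota> m =
     \<lparr>carrier = \<iota> ` coord_vectors m, mult = undefined, one = undefined,
      zero = \<iota> (\<lambda>_. 0), add = (\<lambda>x y. \<iota> (\<lambda>i. inv_into UNIV \<iota> x i + inv_into UNIV \<iota> y i)),
      smult = (\<lambda>a x. \<iota> (\<lambda>i. a * inv_into UNIV \<iota> x i)),
      inner_prod = (\<lambda>x y. \<Sum>i<m. inv_into UNIV \<iota> x i * cnj (inv_into UNIV \<iota> y i))\<rparr>"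

lemma cring_complex_ring: "cring complex_ring"
proof (rule cringI)
  show "abelian_group complex_ring"
    by (rule abelian_groupI) (auto simp: complex_ring_def intro: exI[of _ "- _"])
  show "comm_monoid complex_ring"
    by (rule comm_monoidI) (auto simp: complex_ring_def)
qed (auto simp: complex_ring_def algebra_simps)

locale coordinates =
  fixes \<iota> :: "(nat \<Rightarrow> complex) \<Rightarrow> 'a" and m :: nat
  assumes inj: "inj \<iota>"
begin

abbreviation H where "H \<equiv> coord_space \<iota> m"

lemma inv_coord [simp]: "inv_into UNIV \<iota> (\<iota> f) = f"
  by (rule inv_f_f[OF inj])

lemma coord_space_simps [simp]:
  "carrier H = \<iota> ` coord_vectors m"
  "\<zero>\<^bsub>H\<^esub> = \<iota> (\<lambda>_. 0)"
  "\<iota> f \<oplus>\<^bsub>H\<^esub> \<iota> g = \<iota> (\<lambda>i. f i + g i)"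
  "a \<odot>\<^bsub>H\<^esub> \<iota> f = \<iota> (\<lambda>i. a * f i)"
  "inner_prod H (\<iota> f) (\<iota> g) = (\<Sum>i<m. f i * cnj (g i))"
  by (simp_all add: coord_space_def)

lemma coord_eq_iff [simp]: "\<iota> f = \<iota> g \<longleftrightarrow> f = g"
  by (rule inj_eq[OF inj])

lemma vnorm_coord: "vnorm H (\<iota> f) = L2_set (\<lambda>i. cmod (f i)) {..<m}"
  by (simp add: vnorm_def L2_set_def complex_norm_square[symmetric] flip: of_real_power of_real_sum)

lemma vnorm_smult: "x \<in> carrier H \<Longrightarrow> vnorm H (a \<odot>\<^bsub>H\<^esub> x) = cmod a * vnorm H x"
  by (auto simp: vnorm_coord norm_mult L2_set_right_distrib)

lemma abelian_group_coord_space: "abelian_group H"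
proof (rule abelian_groupI)
  fix x assume "x \<in> carrier H"
  then obtain f where f: "x = \<iota> f" "f \<in> coord_vectors m" by auto
  then show "\<exists>y\<in>carrier H. y \<oplus>\<^bsub>H\<^esub> x = \<zero>\<^bsub>H\<^esub>"
    by (intro bexI[of _ "\<iota> (\<lambda>i. - f i)"]) (auto simp: coord_vectors_def)
qed (auto simp: coord_vectors_def add_ac)

lemma minus_coord:
  assumes "f \<in> coord_vectors m" "g \<in> coord_vectors m"
  shows "\<iota> f \<ominus>\<^bsub>H\<^esub> \<iota> g = \<iota> (\<lambda>i. f i - g i)"
proof -
  interpret abelian_group H by (rule abelian_group_coord_space)
  have "\<ominus>\<^bsub>H\<^esub> \<iota> g = \<iota> (\<lambda>i. - g i)"
    by (rule minus_equality) (use assms in \<open>auto simp: coord_vectors_def\<close>)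
  then show ?thesis by (simp add: a_minus_def)
qed

lemma complex_hilbert_space_coord_space: "complex_hilbert_space H"
proof -
  have "module complex_ring H"
    by (rule moduleI[OF cring_complex_ring abelian_group_coord_space])
       (auto simp: complex_ring_def coord_vectors_def algebra_simps)
  moreover have "complex_hilbert_space_axioms H"
  proof
    fix x assume "x \<in> carrier H" "x \<noteq> \<zero>\<^bsub>H\<^esub>"
    then obtain f where f: "x = \<iota> f" "f \<in> coord_vectors m" "f \<noteq> (\<lambda>_. 0)" by auto
    then obtain i where "f i \<noteq> 0" "i < m" by (force simp: coord_vectors_def not_less[symmetric])
    then have "0 < (\<Sum>i<m. (cmod (f i))\<^sup>2)" by (intro sum_pos2[of _ i]) auto
    then show "0 < Re (inner_prod H x x)"
      by (simp add: f complex_norm_square[symmetric] flip: of_real_power of_real_sum)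
  next
    fix s :: "nat \<Rightarrow> 'a"
    assume s: "range s \<subseteq> carrier H"
      and cauchy: "\<forall>e>0. \<exists>N. \<forall>k\<ge>N. \<forall>l\<ge>N. vnorm H (s k \<ominus>\<^bsub>H\<^esub> s l) < e"
    define F where "F k = inv_into UNIV \<iota> (s k)" for k
    have F: "s k = \<iota> (F k)" "F k \<in> coord_vectors m" for k
      using s by (auto simp: F_def subset_iff image_iff) (metis inv_coord)+
    have "Cauchy (\<lambda>k. F k i)" for i
    proof (cases "i < m")
      case True
      have "cmod (F k i - F l i) \<le> vnorm H (s k \<ominus>\<^bsub>H\<^esub> s l)" for k l
        using True member_le_L2_set[of "{..<m}" i "\<lambda>i. cmod (F k i - F l i)"]
        by (simp add: F minus_coord vnorm_coord)
      then show ?thesis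
        using cauchy unfolding Cauchy_def dist_norm by (meson le_less_trans)
    next
      case False
      then have "F k i = 0" for k using F(2)[of k] by (simp add: coord_vectors_def)
      then show ?thesis by (simp add: convergent_Cauchy convergent_const)
    qed
    then have lim: "(\<lambda>k. F k i) \<longlonglongrightarrow> lim (\<lambda>k. F k i)" for i
      by (simp add: Cauchy_convergent_iff convergent_LIMSEQ_iff)
    \<comment> \<open>Setting the coordinates from \<open>m\<close> on to 0 puts the limit in the
      carrier. Norm convergence follows because only finitely many coordinates enter.\<close>
    define g where "g i = (if i < m then lim (\<lambda>k. F k i) else 0)" for i
    have g: "g \<in> coord_vectors m" by (simp add: coord_vectors_def g_def)
    have "(\<lambda>k. L2_set (\<lambda>i. cmod (F k i - g i)) {..<m}) \<longlonglongrightarrow> sqrt (\<Sum>i<m. (cmod (g i - g i))\<^sup>2)"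
      unfolding L2_set_def by (intro tendsto_intros) (use lim in \<open>auto simp: g_def\<close>)
    then have "(\<lambda>k. vnorm H (s k \<ominus>\<^bsub>H\<^esub> \<iota> g)) \<longlonglongrightarrow> 0"
      by (simp add: F g minus_coord vnorm_coord)
    then show "\<exists>l\<in>carrier H. (\<lambda>k. vnorm H (s k \<ominus>\<^bsub>H\<^esub> l)) \<longlonglongrightarrow> 0"
      using g by auto
  qed (auto simp: sum.distrib algebra_simps sum_distrib_left cnj_sum)
  ultimately show ?thesis by (simp add: complex_hilbert_space_def)
qed

lemma finsum_coord:
  assumes "finite A" "\<And>k. k \<in> A \<Longrightarrow> F k \<in> coord_vectors m"
  shows "finsum H (\<lambda>k. \<iota> (F k)) A = \<iota> (\<lambda>i. \<Sum>k\<in>A. F k i)"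
proof -
  interpret abelian_group H by (rule abelian_group_coord_space)
  show ?thesis using assms
    by (induction A) (auto simp: finsum_insert Pi_def)
qed

section \<open>Operator norms and inverses\<close>

lemma op_norm_le:
  assumes "\<And>x. x \<in> carrier H \<Longrightarrow> vnorm H (A x) \<le> B * vnorm H x" "0 \<le> B"
  shows "op_norm H A \<le> B"
  unfolding op_norm_def
proof (rule cSUP_least)
  have "\<iota> (\<lambda>_. 0) \<in> {x \<in> carrier H. vnorm H x \<le> 1}"
    by (auto simp: vnorm_coord coord_vectors_def L2_set_def)
  then show "{x \<in> carrier H. vnorm H x \<le> 1} \<noteq> {}" by blast
next
  fix x assume "x \<in> {x \<in> carrier H. vnorm H x \<le> 1}"
  then show "vnorm H (A x) \<le> B"
    using assms(1)[of x] mult_left_mono[of "vnorm H x" 1 B] assms(2) by auto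
qed

end

text \<open>A real supremum dominates its members once the set is bounded above; the a priori bound
  \<open>B\<close>, however crude, ensures that.\<close>

lemma le_op_norm:
  assumes "\<And>x. x \<in> carrier H \<Longrightarrow> vnorm H (A x) \<le> B * vnorm H x" "0 \<le> B"
    and "x \<in> carrier H" "vnorm H x \<le> 1"
  shows "vnorm H (A x) \<le> op_norm H A"
  unfolding op_norm_def
proof (rule cSUP_upper)
  show "bdd_above ((\<lambda>x. vnorm H (A x)) ` {x \<in> carrier H. vnorm H x \<le> 1})"
  proof (rule bdd_aboveI2)
    fix y assume "y \<in> {x \<in> carrier H. vnorm H x \<le> 1}"
    then show "vnorm H (A y) \<le> B"
      using assms(1)[of y] mult_left_mono[of "vnorm H y" 1 B] assms(2) by auto
  qed
qed (use assms in auto)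

text \<open>The left inverse \<open>S\<close> makes \<open>A\<close> injective on the carrier, so
  the preimage chosen by \<open>inv_into\<close> can only be \<open>S x\<close>.\<close>

lemma op_inverse_eqI:
  assumes "\<And>y. y \<in> carrier H \<Longrightarrow> S (A y) = y"
    and "x \<in> carrier H" "S x \<in> carrier H" "A (S x) = x"
  shows "op_inverse H A x = S x"
  unfolding op_inverse_def
  by (rule inv_into_f_eq) (use assms in \<open>auto intro: inj_on_inverseI\<close>)

section \<open>Cyclic weighted shifts\<close>

text \<open>
  The powers of the cyclic shift with weights \<open>d (i + 1) / d i\<close>, written as conjugates of the powers
  of the unweighted cyclic shift by the diagonal matrix \<open>d\<close>; in particular the \<open>m\<close>-th power is trivial.
\<close>

definition cyclic_shift :: "(nat \<Rightarrow> real) \<Rightarrow> nat \<Rightarrow> nat \<Rightarrow> (nat \<Rightarrow> complex) \<Rightarrow> nat \<Rightarrow> complex" where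
  "cyclic_shift d m j f i =
     (if i < m then complex_of_real (d ((i + j) mod m) / d i) * f ((i + j) mod m) else 0)"

lemma cyclic_shift_in_coord_vectors [simp]: "cyclic_shift d m j f \<in> coord_vectors m"
  by (simp add: cyclic_shift_def coord_vectors_def)

text \<open>The weights are quotients of values of \<open>d\<close>, so they telescope.\<close>

lemma cyclic_shift_add:
  assumes "\<And>i. d i \<noteq> 0"
  shows "cyclic_shift d m j (cyclic_shift d m k f) = cyclic_shift d m (j + k) f"
  by (rule ext) (auto simp: cyclic_shift_def assms mod_add_left_eq add.assoc)

lemma cyclic_shift_0:
  assumes "\<And>i. d i \<noteq> 0" "f \<in> coord_vectors m"
  shows "cyclic_shift d m 0 f = f"
  using assms by (auto simp: cyclic_shift_def coord_vectors_def)

lemma cyclic_shift_period: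
  assumes "\<And>i. d i \<noteq> 0" "f \<in> coord_vectors m"
  shows "cyclic_shift d m m f = f"
  using assms by (auto simp: cyclic_shift_def coord_vectors_def)

lemma bij_betw_add_mod: "bij_betw (\<lambda>i. (i + j) mod m) {..<m} {..<m}" for m :: nat
proof (rule bij_betw_imageI)
  show inj: "inj_on (\<lambda>i. (i + j) mod m) {..<m}"
  proof (rule inj_onI)
    fix x y assume xy: "x \<in> {..<m}" "y \<in> {..<m}" "(x + j) mod m = (y + j) mod m"
    then obtain k l where "x + j + m * k = y + j + m * l" unfolding nat_mod_eq_iff by blast
    then have "x mod m = y mod m"
      unfolding nat_mod_eq_iff by (intro exI[of _ k] exI[of _ l]) simp
    with xy show "x = y" by simp
  qed
  show "(\<lambda>i. (i + j) mod m) ` {..<m} = {..<m}"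
    by (rule endo_inj_surj[OF _ _ inj]) auto
qed

text \<open>Every weight is at most \<open>B\<close>; what remains is a permutation of the
  coordinates, which preserves the l2 norm.\<close>

lemma L2_set_cyclic_shift_le:
  assumes d: "\<And>i. 0 < d i" and B: "0 \<le> B" "\<And>i. i < m \<Longrightarrow> d ((i + j) mod m) \<le> B * d i"
  shows "L2_set (\<lambda>i. cmod (cyclic_shift d m j f i)) {..<m} \<le> B * L2_set (\<lambda>i. cmod (f i)) {..<m}"
proof -
  have "L2_set (\<lambda>i. cmod (cyclic_shift d m j f i)) {..<m} \<le>
        L2_set (\<lambda>i. B * cmod (f ((i + j) mod m))) {..<m}"
  proof (rule L2_set_mono)
    fix i assume "i \<in> {..<m}"
    moreover from this have "d ((i + j) mod m) / d i \<le> B"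
      using B(2)[of i] d[of i] by (simp add: divide_simps)
    ultimately show "cmod (cyclic_shift d m j f i) \<le> B * cmod (f ((i + j) mod m))"
      using d[of i] d[of "(i + j) mod m"]
      using mult_right_mono[of "d ((i + j) mod m) / d i" B "cmod (f ((i + j) mod m))"]
      by (simp add: cyclic_shift_def norm_mult norm_divide)
  qed simp
  also have "\<dots> = B * L2_set (\<lambda>i. cmod (f ((i + j) mod m))) {..<m}"
    by (rule L2_set_right_distrib[OF B(1), symmetric])
  also have "L2_set (\<lambda>i. cmod (f ((i + j) mod m))) {..<m} = L2_set (\<lambda>i. cmod (f i)) {..<m}"
    unfolding L2_set_def
    using sum.reindex_bij_betw[OF bij_betw_add_mod, of "\<lambda>i. (cmod (f i))\<^sup>2" j m] by simp
  finally show ?thesis .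
qed

section \<open>Shifts as operators, and polynomials in them\<close>

locale cyclic_shift_operator = coordinates \<iota> m
  for \<iota> :: "(nat \<Rightarrow> complex) \<Rightarrow> 'a" and m :: nat +
  fixes d :: "nat \<Rightarrow> real"
  assumes weight_pos: "0 < d i" and size_pos: "0 < m"
begin

definition shift_op :: "nat \<Rightarrow> 'a \<Rightarrow> 'a" where
  "shift_op j x = \<iota> (cyclic_shift d m j (inv_into UNIV \<iota> x))"

lemma weight_nonzero: "d i \<noteq> 0"
  using weight_pos[of i] by simp

lemma shift_op_coord [simp]: "shift_op j (\<iota> f) = \<iota> (cyclic_shift d m j f)"
  by (simp add: shift_op_def)

lemma shift_op_add: "shift_op j (shift_op k x) = shift_op (j + k) x"
  by (simp add: shift_op_def cyclic_shift_add weight_nonzero)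

lemma shift_op_period: "x \<in> carrier H \<Longrightarrow> shift_op m x = x"
  by (auto simp: cyclic_shift_period weight_nonzero)

text \<open>The carrier matters at \<open>j = 0\<close>: \<open>cyclic_shift d m 0\<close> truncates
  at \<open>m\<close>, so it is the identity only on \<open>coord_vectors m\<close>.\<close>

lemma shift_op_power: "x \<in> carrier H \<Longrightarrow> (shift_op (Suc 0) ^^ j) x = shift_op j x"
  by (induction j) (auto simp: shift_op_add cyclic_shift_0 cyclic_shift_add weight_nonzero)

lemma shift_op_closed: "shift_op j x \<in> carrier H"
  by (simp add: shift_op_def)

lemma vnorm_shift_op_le:
  assumes "0 \<le> B" "\<And>i. i < m \<Longrightarrow> d ((i + j) mod m) \<le> B * d i" "x \<in> carrier H"
  shows "vnorm H (shift_op j x) \<le> B * vnorm H x"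
  using assms(3) L2_set_cyclic_shift_le[of d B m j, OF weight_pos assms(1,2)]
  by (auto simp: vnorm_coord)

lemma bounded_op_shift_op:
  assumes "0 \<le> B" "\<And>i. i < m \<Longrightarrow> d ((i + j) mod m) \<le> B * d i"
  shows "bounded_op H (shift_op j)"
  unfolding bounded_op_def
proof (intro conjI)
  show "\<exists>B. \<forall>x\<in>carrier H. vnorm H (shift_op j x) \<le> B * vnorm H x"
    using vnorm_shift_op_le[OF assms] by blast
next
  show "shift_op j \<in> carrier H \<rightarrow> carrier H"
    using shift_op_closed by blast
qed (auto simp: cyclic_shift_def distrib_left mult_ac fun_eq_iff)

lemma poly_op_shift_op:
  assumes f: "f \<in> coord_vectors m"
  shows "poly_op H p (shift_op (Suc 0)) (\<iota> f) =
    \<iota> (\<lambda>i. \<Sum>k\<le>degree p. coeff p k * cyclic_shift d m k f i)"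
proof -
  have "poly_op H p (shift_op (Suc 0)) (\<iota> f) =
      finsum H (\<lambda>k. \<iota> (\<lambda>i. coeff p k * cyclic_shift d m k f i)) {..degree p}"
    unfolding poly_op_def using f by (simp add: shift_op_power)
  also have "\<dots> = \<iota> (\<lambda>i. \<Sum>k\<le>degree p. coeff p k * cyclic_shift d m k f i)"
    by (rule finsum_coord) (auto simp: coord_vectors_def cyclic_shift_def)
  finally show ?thesis .
qed

lemma poly_op_monom:
  assumes "f \<in> coord_vectors m" "c \<noteq> 0"
  shows "poly_op H (monom c k) (shift_op (Suc 0)) (\<iota> f) = \<iota> (\<lambda>i. c * cyclic_shift d m k f i)"
  using assms by (simp add: poly_op_shift_op degree_monom_eq if_distrib[of "\<lambda>x. x * _"] cong: if_cong)

lemma poly_op_monom_period_plus_1: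
  assumes "f \<in> coord_vectors m"
  shows "poly_op H (monom 1 m + 1) (shift_op (Suc 0)) (\<iota> f) = \<iota> (\<lambda>i. 2 * f i)"
proof -
  have "degree (monom 1 m + 1 :: complex poly) = m"
    using size_pos by (simp add: degree_add_eq_left degree_monom_eq)
  \<comment> \<open>Only \<open>k = 0\<close> and \<open>k = m\<close> have nonzero coefficients.
    They differ because \<open>0 < m\<close>, and each contributes \<open>f i\<close> by
    periodicity.\<close>
  moreover have "(\<Sum>k\<le>m. coeff (monom 1 m + 1 :: complex poly) k * cyclic_shift d m k f i) = 2 * f i" for i
    using assms
    by (simp add: distrib_right sum.distrib if_distrib[of "\<lambda>x. x * _"] coeff_1
          cyclic_shift_0 cyclic_shift_period weight_nonzero cong: if_cong)
  ultimately show ?thesis using assms by (simp add: poly_op_shift_op)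
qed

end

section \<open>The extremal operator\<close>

text \<open>The exponent is the distance from \<open>i\<close> to 0 on the cycle of length
  \<open>2 * n\<close>: a tent of height \<open>n\<close>. Its successive ratios are
  \<open>n\<close> factors \<open>R\<close>, then \<open>n\<close> factors
  \<open>1 / R\<close>.\<close>

definition extremal_weight :: "real \<Rightarrow> nat \<Rightarrow> nat \<Rightarrow> real" where
  "extremal_weight R n i = R ^ min i (2 * n - i)"

lemma extremal_weight_le:
  assumes "1 < R" "min ((i + j) mod (2 * n)) (2 * n - (i + j) mod (2 * n)) \<le> k + min i (2 * n - i)"
  shows "extremal_weight R n ((i + j) mod (2 * n)) \<le> R ^ k * extremal_weight R n i"
  using assms unfolding extremal_weight_def
  by (simp flip: power_add)

text \<open>One step on the cycle, forward or (as \<open>2 * n - 1\<close>) backward, changes the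
  distance to 0 by at most 1. For the shift by \<open>n\<close> it suffices that no distance exceeds
  \<open>n\<close>.\<close>

lemma extremal_weight_bounds:
  assumes R: "1 < R" and i: "i < 2 * n"
  shows "extremal_weight R n ((i + 1) mod (2 * n)) \<le> R * extremal_weight R n i"
    and "extremal_weight R n ((i + (2 * n - 1)) mod (2 * n)) \<le> R * extremal_weight R n i"
    and "extremal_weight R n ((i + n) mod (2 * n)) \<le> R ^ n * extremal_weight R n i"
proof -
  have "(i + 1) mod (2 * n) = (if i = 2 * n - 1 then 0 else i + 1)" using i by auto
  then show "extremal_weight R n ((i + 1) mod (2 * n)) \<le> R * extremal_weight R n i"
    using extremal_weight_le[OF R, of i 1 n 1] i by (auto split: if_splits)
  have "(i + (2 * n - 1)) mod (2 * n) = (if i = 0 then 2 * n - 1 else i - 1)"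
    using i by (auto simp: mod_if)
  then show "extremal_weight R n ((i + (2 * n - 1)) mod (2 * n)) \<le> R * extremal_weight R n i"
    using extremal_weight_le[OF R, of i "2 * n - 1" n 1] i by (auto split: if_splits)
  show "extremal_weight R n ((i + n) mod (2 * n)) \<le> R ^ n * extremal_weight R n i"
    by (rule extremal_weight_le[OF R]) linarith
qed

lemma norm_power_add_inverse_le:
  fixes z :: complex
  assumes R: "1 < R" and z: "z \<in> closed_annulus R"
  shows "cmod ((z ^ (2 * n) + 1) / (of_real (R ^ n) * z ^ n)) \<le> 1 + 1 / R ^ (2 * n)"
proof -
  define \<rho> where "\<rho> = cmod z ^ n"
  define s where "s = R ^ n"
  have z0: "0 < cmod z" "cmod z \<le> R" "1 \<le> R * cmod z"
    using z R by (auto simp: closed_annulus_def divide_simps mult.commute intro: less_le_trans[of 0 "1/R"])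
  then have \<rho>: "0 < \<rho>" "\<rho> \<le> s" "1 \<le> s * \<rho>" "0 < s"
    using R by (auto simp: \<rho>_def s_def power_mono simp flip: power_mult_distrib)
  \<comment> \<open>The factors vanish at the ends of the range from 1/s to s of \<rho>; expanded,
    this says \<rho> + 1/\<rho> \<le> s + 1/s.\<close>
  have "0 \<le> (s - \<rho>) * (s * \<rho> - 1)" using \<rho> by simp
  then have "(\<rho>\<^sup>2 + 1) * s \<le> (s\<^sup>2 + 1) * \<rho>" by (simp add: algebra_simps power2_eq_square)
  then have "(\<rho>\<^sup>2 + 1) / (s * \<rho>) \<le> 1 + 1 / s\<^sup>2"
    using \<rho> by (simp add: divide_simps power2_eq_square mult_ac)
  moreover have "cmod (z ^ (2 * n) + 1) \<le> \<rho>\<^sup>2 + 1"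
    using norm_triangle_ineq[of "z ^ (2 * n)" 1]
    by (simp add: \<rho>_def norm_power power_even_eq)
  then have "cmod ((z ^ (2 * n) + 1) / (of_real (R ^ n) * z ^ n)) \<le> (\<rho>\<^sup>2 + 1) / (s * \<rho>)"
    using \<rho> R by (simp add: norm_divide norm_mult norm_power \<rho>_def s_def divide_right_mono)
  ultimately show ?thesis by (simp add: s_def power_even_eq)
qed

section \<open>Lower bound on admissible constants for fixed n\<close>

lemma annulus_bound_ge:
  fixes \<iota> :: "(nat \<Rightarrow> complex) \<Rightarrow> 'a"
  assumes inj: "inj \<iota>" and R: "1 < R" and K: "annulus_bound TYPE('a) R K" and n: "0 < n"
  shows "2 \<le> K * (1 + 1 / R ^ (2 * n))"
proof -
  interpret cyclic_shift_operator \<iota> "2 * n" "extremal_weight R n"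
    by standard (use inj R n in \<open>auto simp: extremal_weight_def\<close>)
  note shift_le = vnorm_shift_op_le[OF _ extremal_weight_bounds(1)[OF R]]
    vnorm_shift_op_le[OF _ extremal_weight_bounds(2)[OF R]]
    vnorm_shift_op_le[OF _ extremal_weight_bounds(3)[OF R]]
  \<comment> \<open>The power \<open>2 * n - 1\<close> of the shift is its inverse, by
    periodicity.\<close>
  let ?T = "shift_op (Suc 0)" and ?S = "shift_op (2 * n - 1)"
  have inverse: "?S (?T x) = x" "?T (?S x) = x" if "x \<in> carrier H" for x
    using that n by (simp_all only: shift_op_add) (simp_all add: shift_op_period del: coord_space_simps)
  have "bounded_op H ?T" "bounded_op H ?S"
    using bounded_op_shift_op[OF _ extremal_weight_bounds(1)[OF R]]
      bounded_op_shift_op[OF _ extremal_weight_bounds(2)[OF R]] R by auto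
  moreover from this have "invertible_op H ?T"
    unfolding invertible_op_def using inverse by blast
  moreover have "op_norm H ?T \<le> R"
    using R shift_le(1) by (intro op_norm_le) (simp_all del: coord_space_simps)
  moreover have "op_inverse H ?T x = ?S x" if "x \<in> carrier H" for x
    using that inverse shift_op_closed by (intro op_inverse_eqI)
  then have "op_norm H (op_inverse H ?T) \<le> R"
    using R shift_le(2) by (intro op_norm_le) (simp_all del: coord_space_simps)
  ultimately have spectral: "spectral_set H ?T K (closed_annulus R)"
    using K complex_hilbert_space_coord_space unfolding annulus_bound_def by blast

  define c :: complex where "c = of_real (R ^ n)"
  have c: "c \<noteq> 0" using R by (simp add: c_def)
  \<comment> \<open>The test function is multiplied through by z^n to become a quotient of
    polynomials; the only zero of \<open>q\<close> is 0, outside the annulus.\<close>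
  define p :: "complex poly" where "p = monom 1 (2 * n) + 1"
  define q :: "complex poly" where "q = monom c n"
  have f_le: "cmod (poly p z / poly q z) \<le> 1 + 1 / R ^ (2 * n)" if "z \<in> closed_annulus R" for z
    using norm_power_add_inverse_le[OF R that, of n] by (simp add: p_def q_def c_def poly_monom)
  have "z \<noteq> 0" if "z \<in> closed_annulus R" for z
    using that R by (auto simp: closed_annulus_def divide_simps)
  then have "bounded_rational_on (closed_annulus R) p q"
    unfolding bounded_rational_on_def using f_le c
    by (auto simp: bounded_iff q_def poly_monom)
  then have "op_norm H (rational_op H p q ?T) \<le>
      K * sup_norm_on (closed_annulus R) (\<lambda>z. poly p z / poly q z)"
    using spectral unfolding spectral_set_def by blast
  also have "sup_norm_on (closed_annulus R) (\<lambda>z. poly p z / poly q z) \<le> 1 + 1 / R ^ (2 * n)"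
    unfolding sup_norm_on_def
  proof (rule cSUP_least[OF _ f_le])
    show "closed_annulus R \<noteq> {}"
      using R by (auto simp: closed_annulus_def intro!: exI[of _ 1])
  qed
  finally have upper: "op_norm H (rational_op H p q ?T) \<le> K * (1 + 1 / R ^ (2 * n))"
    using K by (simp add: annulus_bound_def mult_left_mono)

  \<comment> \<open>\<open>Q\<close> inverts q(T) = c T^n: by periodicity T^n is its own
    inverse.\<close>
  define Q where "Q x = (1 / c) \<odot>\<^bsub>H\<^esub> shift_op n x" for x
  have Q: "Q (poly_op H q ?T x) = x" "poly_op H q ?T (Q x) = x" "Q x \<in> carrier H"
    if x: "x \<in> carrier H" for x
  proof -
    obtain f where f: "x = \<iota> f" "f \<in> coord_vectors (2 * n)" using x by auto
    have scale: "cyclic_shift (extremal_weight R n) (2 * n) n (\<lambda>i. a * g i) =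
        (\<lambda>i. a * cyclic_shift (extremal_weight R n) (2 * n) n g i)" for a g
      by (auto simp: cyclic_shift_def)
    have per: "cyclic_shift (extremal_weight R n) (2 * n) n
        (cyclic_shift (extremal_weight R n) (2 * n) n f) = f"
      using f cyclic_shift_period[OF weight_nonzero, of f]
      by (simp add: cyclic_shift_add weight_nonzero flip: mult_2)
    have mem: "(\<lambda>i. 1 / c * cyclic_shift (extremal_weight R n) (2 * n) n f i) \<in> coord_vectors (2 * n)"
      by (simp add: coord_vectors_def cyclic_shift_def)
    show "Q x \<in> carrier H" using mem f by (simp add: Q_def)
    show "Q (poly_op H q ?T x) = x" "poly_op H q ?T (Q x) = x"
      using f c mem by (simp_all add: Q_def q_def poly_op_monom scale scale[of "1 / c", simplified] per)
  qed
  have rational: "rational_op H p q ?T x = (2 / c) \<odot>\<^bsub>H\<^esub> shift_op n x" if x: "x \<in> carrier H" for x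
  proof -
    have "rational_op H p q ?T x = poly_op H p ?T (Q x)"
      unfolding rational_op_def comp_def
      using op_inverse_eqI[where A = "poly_op H q ?T" and S = Q and H = H, OF Q(1) x Q(3)[OF x] Q(2)[OF x]]
      by simp
    \<comment> \<open>By periodicity p(T) is twice the identity on the carrier.\<close>
    also have "\<dots> = (2 / c) \<odot>\<^bsub>H\<^esub> shift_op n x"
    proof -
      obtain f where f: "x = \<iota> f" using x by auto
      have "(\<lambda>i. 1 / c * cyclic_shift (extremal_weight R n) (2 * n) n f i) \<in> coord_vectors (2 * n)"
        by (simp add: coord_vectors_def cyclic_shift_def)
      from poly_op_monom_period_plus_1[OF this] show ?thesis
        by (simp add: Q_def p_def f)
    qed
    finally show ?thesis .
  qed
  have vnorm_rational: "vnorm H (rational_op H p q ?T x) = 2 / R ^ n * vnorm H (shift_op n x)"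
    if "x \<in> carrier H" for x
    using R by (simp add: rational[OF that] vnorm_smult[OF shift_op_closed] norm_divide norm_power c_def
      del: coord_space_simps)
  \<comment> \<open>This supplies the a priori bound that \<open>le_op_norm\<close> requires
    below.\<close>
  have rational_le: "vnorm H (rational_op H p q ?T x) \<le> 2 * vnorm H x" if "x \<in> carrier H" for x
    using shift_le(3)[of x] that R
    by (simp add: vnorm_rational divide_simps mult.commute[of _ "R ^ n"] del: coord_space_simps)

  \<comment> \<open>The basis vector at the top of the tent: T^n moves it to coordinate 0 with
    weight \<open>d n / d 0\<close>, which is \<open>R ^ n\<close>.\<close>
  define e :: "nat \<Rightarrow> complex" where "e i = (if i = n then 1 else 0)" for i
  have e: "\<iota> e \<in> carrier H" using n by (auto simp: coord_vectors_def e_def)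
  have norm_e: "vnorm H (\<iota> e) \<le> 1"
    using n by (simp add: vnorm_coord L2_set_def e_def if_distrib[of cmod] if_distrib[of "\<lambda>x. x\<^sup>2"] cong: if_cong)
  have "R ^ n = cmod (cyclic_shift (extremal_weight R n) (2 * n) n e 0)"
    using n R by (simp add: cyclic_shift_def e_def extremal_weight_def norm_power)
  also have "\<dots> \<le> vnorm H (shift_op n (\<iota> e))"
    using n member_le_L2_set[of "{..<2 * n}" 0 "\<lambda>i. cmod (cyclic_shift (extremal_weight R n) (2 * n) n e i)"]
    by (simp add: vnorm_coord)
  finally have "2 \<le> vnorm H (rational_op H p q ?T (\<iota> e))"
    using R by (simp add: vnorm_rational[OF e] divide_simps)
  also have "\<dots> \<le> op_norm H (rational_op H p q ?T)"
    using le_op_norm[OF rational_le _ e norm_e] by simp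
  finally show ?thesis using upper by simp
qed

theorem theorem1p1:
  fixes R :: real
  assumes "\<exists>\<iota> :: (nat \<Rightarrow> complex) \<Rightarrow> 'a. inj \<iota>"
    and "R > 1"
  shows "annulus_constant TYPE('a) R \<ge> 2"
  unfolding annulus_constant_def
proof (rule Inf_greatest)
  fix k assume "k \<in> ereal ` {K. annulus_bound TYPE('a) R K}"
  then obtain K where k: "k = ereal K" and K: "annulus_bound TYPE('a) R K" by blast
  obtain \<iota> :: "(nat \<Rightarrow> complex) \<Rightarrow> 'a" where "inj \<iota>" using assms(1) by blast
  then have ge: "2 \<le> K * (1 + 1 / R ^ (2 * n))" if "0 < n" for n
    using annulus_bound_ge assms(2) K that by blast
  \<comment> \<open>\<open>R ^ (2 * n)\<close> is regrouped as a power of \<open>R\<^sup>2\<close>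
    to get a geometric sequence; \<open>K\<close> does not depend on \<open>n\<close>, so the bounds
    pass to the limit.\<close>
  have "(\<lambda>n. K * (1 + (1 / R\<^sup>2) ^ n)) \<longlonglongrightarrow> K * (1 + 0)"
    using assms(2) by (intro tendsto_intros LIMSEQ_power_zero) (simp add: one_less_power)
  then have "2 \<le> K * (1 + 0)"
    by (rule LIMSEQ_le_const) (use ge in \<open>auto intro!: exI[of _ 1] simp: power_one_over power_mult\<close>)
  then show "2 \<le> k" by (simp add: k)
qed

end
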